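(* For every positive integer $k$, there exist infinitely many pairs of connected (simple) graphs $G$ and $H$ with $G\subset H$, $V(G)=V(H)$ and $|E(H)\setminus E(G)|=k$ such that $\mu(H)<\mu(G)$.
   Context: All graphs are finite and simple. A subtree of a graph $G$ is a (nonempty) subgraph of $G$ that is a tree. The mean subtree order $\mu(G)$ of $G$ is the average number of vertices of a subtree of $G$, i.e. $\mu(G)=\frac{\sum_{T\in\mathcal{T}_G}|V(T)|}{|\mathcal{T}_G|}$, where $\mathcal{T}_G$ is the family of all subtrees of $G$. *)

theory Defs
  imports Complex_Main
begin

datatype 'a sgraph = SGraph (verts: "'a set") (edges: "'a set set")

definition simple_graph :: "'a sgraph \<Rightarrow> bool" where
  "simple_graph G \<longleftrightarrow>
     finite (verts G) \<and> (\<forall>e\<in>edges G. e \<subseteq> verts G \<and> card e = 2)"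

definition subgraph :: "'a sgraph \<Rightarrow> 'a sgraph \<Rightarrow> bool" where
  "subgraph G H \<longleftrightarrow> simple_graph G \<and> simple_graph H \<and> verts G \<subseteq> verts H \<and> edges G \<subseteq> edges H"

definition adj :: "'a sgraph \<Rightarrow> ('a \<times> 'a) set" where
  "adj G = {(u, v). {u, v} \<in> edges G}"

text \<open>The graph without vertices is not connected, so subtrees are nonempty.\<close>

definition connected_graph :: "'a sgraph \<Rightarrow> bool" where
  "connected_graph G \<longleftrightarrow>
     simple_graph G \<and> verts G \<noteq> {} \<and> (\<forall>u\<in>verts G. \<forall>v\<in>verts G. (u, v) \<in> (adj G)\<^sup>*)"

definition is_cycle :: "'a sgraph \<Rightarrow> 'a list \<Rightarrow> bool" where
  "is_cycle G c \<longleftrightarrow> distinct c \<and> 3 \<le> length c \<and>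
     (\<forall>i<length c. {c ! i, c ! ((i + 1) mod length c)} \<in> edges G)"

definition is_tree :: "'a sgraph \<Rightarrow> bool" where
  "is_tree T \<longleftrightarrow> connected_graph T \<and> (\<nexists>c. is_cycle T c)"

definition subtrees :: "'a sgraph \<Rightarrow> 'a sgraph set" where
  "subtrees G = {T. subgraph T G \<and> is_tree T}"

definition mean_subtree_order :: "'a sgraph \<Rightarrow> real" where
  "mean_subtree_order G = (\<Sum>T\<in>subtrees G. real (card (verts T))) / real (card (subtrees G))"

definition graph_iso :: "('a \<Rightarrow> 'b) \<Rightarrow> 'a sgraph \<Rightarrow> 'b sgraph \<Rightarrow> bool" where
  "graph_iso f G G' \<longleftrightarrow>
     bij_betw f (verts G) (verts G') \<and> edges G' = (\<lambda>e. f ` e) ` edges G"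

text \<open>Pairs of graphs on a common vertex set are compared up to a common relabelling of the
  vertices.\<close>

definition pair_isomorphic :: "'a sgraph \<times> 'a sgraph \<Rightarrow> 'b sgraph \<times> 'b sgraph \<Rightarrow> bool" where
  "pair_isomorphic p q \<longleftrightarrow> (\<exists>f. graph_iso f (fst p) (fst q) \<and> graph_iso f (snd p) (snd q))"

end

theory Submission
  imports Defs "HOL-Real_Asymp.Real_Asymp"
begin

text \<open>Take a path and attach \<open>s\<close> leaves to each of its two end vertices. For large \<open>s\<close> almost
  all subtrees contain both ends, since these offer \<open>4 ^ s\<close> choices of leaves and the other
  subtrees at most \<open>2 ^ s\<close> up to a constant factor. Hence \<open>\<mu> - s\<close> tends to the mean order of those
  subtrees of the core that contain both ends. For the path only the whole path qualifies,
  so adding any edges to the core, one of them joining the two ends, lowers this limit.\<close>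

section \<open>Adding a leaf preserves connectedness and acyclicity\<close>

definition add_leaf :: "'a \<Rightarrow> 'a \<Rightarrow> 'a sgraph \<Rightarrow> 'a sgraph" where
  "add_leaf u x G = SGraph (insert x (verts G)) (insert {u, x} (edges G))"

lemma verts_add_leaf [simp]: "verts (add_leaf u x G) = insert x (verts G)"
  and edges_add_leaf [simp]: "edges (add_leaf u x G) = insert {u, x} (edges G)"
  by (simp_all add: add_leaf_def)

lemma sgraph_eqI: "verts G = verts H \<Longrightarrow> edges G = edges H \<Longrightarrow> G = H"
  by (cases G; cases H) simp

lemma simple_graph_edge_verts:
  assumes "simple_graph G" "{a, b} \<in> edges G"
  shows "a \<in> verts G" "b \<in> verts G" "a \<noteq> b"
proof -
  have "{a, b} \<subseteq> verts G" "card {a, b} = 2"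
    using assms unfolding simple_graph_def by blast+
  then show "a \<in> verts G" "b \<in> verts G" "a \<noteq> b"
    by auto
qed

lemma sym_adj: "sym (adj G)"
  by (auto simp: sym_def adj_def insert_commute)

lemma adj_mono: "edges G \<subseteq> edges H \<Longrightarrow> adj G \<subseteq> adj H"
  by (auto simp: adj_def)

lemma simple_graph_add_leaf:
  assumes "simple_graph G" "u \<in> verts G" "x \<notin> verts G"
  shows "simple_graph (add_leaf u x G)"
  using assms unfolding simple_graph_def by (auto simp: card_insert_if)

lemma connected_graph_add_leaf:
  assumes G: "connected_graph G" and u: "u \<in> verts G" and x: "x \<notin> verts G"
  shows "connected_graph (add_leaf u x G)"
proof -
  let ?r = "(adj (add_leaf u x G))\<^sup>*"
  have mono: "(adj G)\<^sup>* \<subseteq> ?r"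
    by (intro rtrancl_mono adj_mono) auto
  have sym: "sym ?r"
    by (rule sym_rtrancl[OF sym_adj])
  have ux: "(u, x) \<in> ?r"
    by (rule r_into_rtrancl) (simp add: adj_def)
  have hub: "(u, a) \<in> ?r" if "a \<in> verts (add_leaf u x G)" for a
    using that G u ux mono unfolding connected_graph_def by auto
  have "(a, b) \<in> ?r"
    if "a \<in> verts (add_leaf u x G)" "b \<in> verts (add_leaf u x G)" for a b
    using hub[OF that(1)] hub[OF that(2)] sym by (meson rtrancl_trans symE)
  moreover have "simple_graph (add_leaf u x G)"
    using G u x by (simp add: connected_graph_def simple_graph_add_leaf)
  ultimately show ?thesis
    by (auto simp: connected_graph_def)
qed

lemma is_cycle_mono: "is_cycle G c \<Longrightarrow> edges G \<subseteq> edges H \<Longrightarrow> is_cycle H c"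
  by (auto simp: is_cycle_def)

text \<open>A vertex on a cycle has two distinct neighbours there, whereas the leaf \<open>x\<close>
  is adjacent only to \<open>u\<close>. So the cycle avoids \<open>x\<close>, and with it the edge
  \<open>{u, x}\<close>.\<close>

lemma is_cycle_add_leafD:
  assumes c: "is_cycle (add_leaf u x G) c" and G: "simple_graph G" and x: "x \<notin> verts G"
  shows "is_cycle G c"
proof -
  let ?l = "length c"
  have d: "distinct c" and l: "3 \<le> ?l"
    and e: "\<And>i. i < ?l \<Longrightarrow> {c ! i, c ! ((i + 1) mod ?l)} \<in> insert {u, x} (edges G)"
    using c by (auto simp: is_cycle_def)
  have leaf: "b = u" if "{x, b} \<in> insert {u, x} (edges G)" for b
    using that simple_graph_edge_verts[OF G, of x b] x by (auto simp: doubleton_eq_iff)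
  have x_notin: "c ! i \<noteq> x" if i: "i < ?l" for i
  proof
    assume ci: "c ! i = x"
    \<comment> \<open>\<open>j\<close> is the cyclic predecessor of \<open>i\<close> and
      \<open>m\<close> below its successor. They differ because the length is at least 3, so
      \<open>u\<close> would occur twice in a distinct list.\<close>
    define j where "j = (if i = 0 then ?l - 1 else i - 1)"
    have j: "j < ?l" "(j + 1) mod ?l = i"
      using i l by (auto simp: j_def)
    define m where "m = (i + 1) mod ?l"
    have m: "m < ?l" "m \<noteq> j"
      using i l by (auto simp: m_def j_def mod_Suc split: if_splits)
    have "c ! m = u"
      using leaf[of "c ! m"] e[OF i] ci by (simp add: m_def)
    moreover have "c ! j = u"
      using leaf[of "c ! j"] e[OF j(1)] ci by (simp add: j(2)[simplified] insert_commute)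
    ultimately show False
      using d m j(1) nth_eq_iff_index_eq[of c m j] by simp
  qed
  have "{c ! i, c ! ((i + 1) mod ?l)} \<in> edges G" if i: "i < ?l" for i
  proof -
    have "(i + 1) mod ?l < ?l" using l by (intro mod_less_divisor) linarith
    then show ?thesis
      using e[OF i] x_notin[OF i] x_notin[of "(i + 1) mod ?l"] by (auto simp: doubleton_eq_iff)
  qed
  with d l show ?thesis by (simp add: is_cycle_def)
qed

lemma is_tree_add_leaf:
  assumes "is_tree G" "u \<in> verts G" "x \<notin> verts G"
  shows "is_tree (add_leaf u x G)"
proof -
  have "simple_graph G" using assms(1) by (simp add: is_tree_def connected_graph_def)
  then show ?thesis
    using assms connected_graph_add_leaf[of G u x] is_cycle_add_leafD[of u x G]
    by (auto simp: is_tree_def)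
qed

section \<open>Subtrees of a graph with one leaf added\<close>

lemma is_tree_singleton: "is_tree (SGraph {x} {})"
  by (auto simp: is_tree_def connected_graph_def simple_graph_def is_cycle_def intro!: exI[of _ 0])

lemma subgraph_add_leaf:
  assumes "simple_graph G" "u \<in> verts G" "x \<notin> verts G"
  shows "subgraph G (add_leaf u x G)"
  using assms by (auto simp: subgraph_def simple_graph_add_leaf)

lemma subgraph_trans: "subgraph G H \<Longrightarrow> subgraph H K \<Longrightarrow> subgraph G K"
  by (auto simp: subgraph_def)

lemma singleton_subtree: "simple_graph G \<Longrightarrow> x \<in> verts G \<Longrightarrow> SGraph {x} {} \<in> subtrees G"
  by (auto simp: subtrees_def is_tree_singleton) (auto simp: subgraph_def simple_graph_def)

lemma finite_subtrees:
  assumes "simple_graph G"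
  shows "finite (subtrees G)"
proof -
  have "finite (verts G)" using assms by (simp add: simple_graph_def)
  moreover have "edges G \<subseteq> Pow (verts G)" using assms by (auto simp: simple_graph_def)
  ultimately have "finite (edges G)" by (meson finite_Pow_iff finite_subset)
  moreover have "subtrees G \<subseteq> (\<lambda>(V, E). SGraph V E) ` (Pow (verts G) \<times> Pow (edges G))"
  proof
    fix T assume "T \<in> subtrees G"
    then have "verts T \<subseteq> verts G" "edges T \<subseteq> edges G"
      by (auto simp: subtrees_def subgraph_def)
    then show "T \<in> (\<lambda>(V, E). SGraph V E) ` (Pow (verts G) \<times> Pow (edges G))"
      by (intro image_eqI[of _ _ "(verts T, edges T)"]) auto
  qed
  ultimately show ?thesis
    using \<open>finite (verts G)\<close> by (meson finite_Pow_iff finite_SigmaI finite_imageI finite_subset)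
qed

text \<open>A subtree may avoid \<open>x\<close>, contain \<open>x\<close> without the edge to
  \<open>u\<close>, or contain both. In the second case \<open>x\<close> is isolated, so
  connectedness leaves only \<open>x\<close>; in the third, deleting \<open>x\<close> leaves a
  tree.\<close>

lemma subtree_add_leaf_cases:
  assumes T: "T \<in> subtrees (add_leaf u x G)"
    and G: "simple_graph G" and u: "u \<in> verts G" and x: "x \<notin> verts G"
  shows "T \<in> subtrees G \<or> T = SGraph {x} {} \<or>
    (\<exists>T'\<in>subtrees G. u \<in> verts T' \<and> T = add_leaf u x T')"
proof -
  have simT: "simple_graph T" and vT: "verts T \<subseteq> insert x (verts G)"
    and eT: "edges T \<subseteq> insert {u, x} (edges G)"
    and conT: "\<And>a b. a \<in> verts T \<Longrightarrow> b \<in> verts T \<Longrightarrow> (a, b) \<in> (adj T)\<^sup>*"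
    and acyT: "\<nexists>c. is_cycle T c" and treeT: "is_tree T"
    using T by (auto simp: subtrees_def subgraph_def is_tree_def connected_graph_def)
  have leaf: "b = u" if "{x, b} \<in> edges T" for b
    using that eT simple_graph_edge_verts[OF G, of x b] x by (auto simp: doubleton_eq_iff)
  have xu: "x \<noteq> u" using u x by auto
  consider "x \<notin> verts T" | "x \<in> verts T" "{x, u} \<notin> edges T" | "x \<in> verts T" "{x, u} \<in> edges T"
    by blast
  then show ?thesis
  proof cases
    case 1
    then have "{u, x} \<notin> edges T"
      using simple_graph_edge_verts[OF simT] by blast
    with 1 vT eT have "subgraph T G"
      using simT G by (auto simp: subgraph_def)
    with treeT show ?thesis by (simp add: subtrees_def)
  next
    case 2
    have "a = x" if "a \<in> verts T" for a
      \<comment> \<open>A nontrivial walk from \<open>x\<close> to \<open>a\<close> would have to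
        start with the missing edge to \<open>u\<close>.\<close>
      using conT[OF 2(1) that]
    proof (cases rule: converse_rtranclE)
      case (step b)
      then show ?thesis using leaf[of b] 2 by (auto simp: adj_def)
    qed simp
    with 2 have V: "verts T = {x}" by blast
    moreover have "edges T = {}"
    proof (rule equals0I)
      fix e assume "e \<in> edges T"
      then have "e \<subseteq> {x}" "card e = 2" using simT V by (auto simp: simple_graph_def)
      then show False by (auto simp: subset_singleton_iff)
    qed
    ultimately show ?thesis by (auto intro: sgraph_eqI)
  next
    case 3
    define T' where "T' = SGraph (verts T - {x}) (edges T - {{u, x}})"
    have uT: "u \<in> verts T" using simple_graph_edge_verts[OF simT 3(2)] by blast
    have x_notin: "x \<notin> e" if "e \<in> edges T'" for e
      using that eT G x by (auto simp: T'_def simple_graph_def)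
    have simT': "simple_graph T'"
      using simT x_notin by (auto simp: simple_graph_def T'_def)
    have keep: "(b, c) \<in> adj T'" if "(b, c) \<in> adj T" "b \<noteq> x" "c \<noteq> x" for b c
      using that by (auto simp: adj_def T'_def doubleton_eq_iff)
    \<comment> \<open>While the walk stands at \<open>x\<close>, the invariant records a walk to
      \<open>u\<close> instead. As \<open>x\<close> is entered and left only through
      \<open>u\<close>, this cuts out every detour over \<open>x\<close>.\<close>
    have walk: "(b \<noteq> x \<longrightarrow> (a, b) \<in> (adj T')\<^sup>*) \<and> (b = x \<longrightarrow> (a, u) \<in> (adj T')\<^sup>*)"
      if "(a, b) \<in> (adj T)\<^sup>*" "a \<noteq> x" for a b
      using that
    proof (induction rule: rtrancl_induct)
      case (step b c)
      show ?case
      proof (cases "b = x \<or> c = x")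
        case True
        then have "b = x \<and> c = u \<or> c = x \<and> b = u"
          using step.hyps(2) leaf by (auto simp: adj_def insert_commute)
        then show ?thesis using step xu by auto
      next
        case False
        then show ?thesis
          using keep[OF step.hyps(2)] step.IH step.prems by (auto intro: rtrancl_into_rtrancl)
      qed
    qed simp
    have "connected_graph T'"
      unfolding connected_graph_def
    proof (intro conjI ballI)
      show "verts T' \<noteq> {}" using uT xu by (auto simp: T'_def)
      fix a b assume "a \<in> verts T'" "b \<in> verts T'"
      then show "(a, b) \<in> (adj T')\<^sup>*" using walk[of a b] conT[of a b] by (auto simp: T'_def)
    qed (fact simT')
    moreover have "\<nexists>c. is_cycle T' c"
      using acyT is_cycle_mono[of T' _ T] by (auto simp: T'_def)
    moreover have "subgraph T' G"
      using simT' G vT eT by (auto simp: subgraph_def T'_def)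
    ultimately have "T' \<in> subtrees G" by (simp add: subtrees_def is_tree_def)
    moreover have "u \<in> verts T'" using uT xu by (simp add: T'_def)
    moreover have "T = add_leaf u x T'"
      using 3 by (intro sgraph_eqI) (auto simp: T'_def insert_commute)
    ultimately show ?thesis by blast
  qed
qed

lemma add_leaf_subtree:
  assumes "simple_graph G" "x \<notin> verts G" and T: "T \<in> subtrees G" "u \<in> verts T"
  shows "add_leaf u x T \<in> subtrees (add_leaf u x G)"
proof -
  have "u \<in> verts G" "x \<notin> verts T" "is_tree T"
    using assms by (auto simp: subtrees_def subgraph_def)
  then show ?thesis
    using assms is_tree_add_leaf[of T u x] simple_graph_add_leaf[of G u x]
    by (auto simp: subtrees_def subgraph_def simple_graph_add_leaf)
qed

lemma subtrees_add_leaf: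
  assumes G: "simple_graph G" and u: "u \<in> verts G" and x: "x \<notin> verts G"
  shows "subtrees (add_leaf u x G) =
    subtrees G \<union> add_leaf u x ` {T \<in> subtrees G. u \<in> verts T} \<union> {SGraph {x} {}}"
proof -
  have "subtrees G \<subseteq> subtrees (add_leaf u x G)"
    using subgraph_trans[OF _ subgraph_add_leaf[OF assms]] by (auto simp: subtrees_def)
  moreover have "SGraph {x} {} \<in> subtrees (add_leaf u x G)"
    using simple_graph_add_leaf[OF assms] by (intro singleton_subtree) auto
  ultimately show ?thesis
    using add_leaf_subtree[OF G x] subtree_add_leaf_cases[OF _ assms] by blast
qed

section \<open>Counting subtrees that contain prescribed vertices\<close>

text \<open>The sets \<open>X\<close> that occur are the empty set, each end of the core alone, and
  both ends. Allowing the empty set lets one decomposition serve all the counts.\<close>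

definition subtrees_containing :: "'a set \<Rightarrow> 'a sgraph \<Rightarrow> 'a sgraph set" where
  "subtrees_containing X G = {T \<in> subtrees G. X \<subseteq> verts T}"

lemma subtrees_containing_empty [simp]: "subtrees_containing {} G = subtrees G"
  by (simp add: subtrees_containing_def)

lemma finite_subtrees_containing: "simple_graph G \<Longrightarrow> finite (subtrees_containing X G)"
  by (simp add: subtrees_containing_def finite_subtrees)

lemma notin_subtree: "T \<in> subtrees G \<Longrightarrow> x \<notin> verts G \<Longrightarrow> x \<notin> verts T"
  by (auto simp: subtrees_def subgraph_def)

lemma notin_subtree_edges: "T \<in> subtrees G \<Longrightarrow> x \<notin> verts G \<Longrightarrow> {u, x} \<notin> edges T"
  using simple_graph_edge_verts(2)[of T u x] by (auto simp: subtrees_def subgraph_def)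

lemma inj_on_add_leaf:
  assumes x: "x \<notin> verts G"
  shows "inj_on (add_leaf u x) (subtrees_containing X G)"
proof (rule inj_onI)
  fix S T assume *: "S \<in> subtrees_containing X G" "T \<in> subtrees_containing X G"
    "add_leaf u x S = add_leaf u x T"
  then have S: "S \<in> subtrees G" and T: "T \<in> subtrees G"
    by (auto simp: subtrees_containing_def)
  have "insert x (verts S) = insert x (verts T)"
    "insert {u, x} (edges S) = insert {u, x} (edges T)"
    using *(3) by (auto simp: add_leaf_def)
  then show "S = T"
    using notin_subtree[OF S x] notin_subtree[OF T x]
      notin_subtree_edges[OF S x] notin_subtree_edges[OF T x]
    by (intro sgraph_eqI) (simp_all add: insert_ident)
qed

text \<open>The leaf can be attached only to a tree through \<open>u\<close>, hence
  \<open>insert u X\<close>. The isolated tree on \<open>x\<close> counts only for empty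
  \<open>X\<close>, since \<open>x\<close> is outside \<open>X\<close>.\<close>

lemma subtrees_containing_add_leaf:
  assumes "simple_graph G" "u \<in> verts G" "x \<notin> verts G" "X \<subseteq> verts G"
  shows "subtrees_containing X (add_leaf u x G) =
    subtrees_containing X G \<union> add_leaf u x ` subtrees_containing (insert u X) G
      \<union> (if X = {} then {SGraph {x} {}} else {})"
proof -
  have "x \<notin> X" using assms by auto
  then show ?thesis
    using assms(4) by (auto simp: subtrees_containing_def subtrees_add_leaf[OF assms(1-3)] subset_insert)
qed

lemma disjoint_add_leaf:
  assumes x: "x \<notin> verts G"
  shows "subtrees_containing X G \<inter> add_leaf u x ` subtrees_containing Y G = {}"
  using notin_subtree[OF _ x] by (force simp: subtrees_containing_def)

text \<open>If \<open>u\<close> already lies in \<open>X\<close>, both summands agree and the count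
  doubles. Two leaves per round thus give the factor 4 for trees through both ends.\<close>

lemma card_subtrees_containing_add_leaf:
  assumes "simple_graph G" "u \<in> verts G" "x \<notin> verts G" "X \<subseteq> verts G" "X \<noteq> {}"
  shows "card (subtrees_containing X (add_leaf u x G)) =
    card (subtrees_containing X G) + card (subtrees_containing (insert u X) G)"
  using assms
  by (simp add: subtrees_containing_add_leaf card_Un_disjoint disjoint_add_leaf
      finite_subtrees_containing card_image inj_on_add_leaf)

lemma card_subtrees_add_leaf:
  assumes G: "simple_graph G" and u: "u \<in> verts G" and x: "x \<notin> verts G"
  shows "card (subtrees (add_leaf u x G)) =
    card (subtrees G) + card (subtrees_containing {u} G) + 1"
proof -
  let ?A = "subtrees_containing {} G" and ?B = "add_leaf u x ` subtrees_containing {u} G"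
  have "SGraph {x} {} \<notin> ?A"
    using notin_subtree[OF _ x, of "SGraph {x} {}"] by (auto simp: subtrees_containing_def)
  moreover have "SGraph {x} {} \<notin> ?B"
    by (auto simp: add_leaf_def)
  ultimately have "card (insert (SGraph {x} {}) (?A \<union> ?B)) = card ?A + card ?B + 1"
    using disjoint_add_leaf[OF x, of "{}" u "{u}"] finite_subtrees_containing[OF G]
    by (simp add: card_Un_disjoint del: subtrees_containing_empty)
  then show ?thesis
    using subtrees_containing_add_leaf[OF assms, of "{}"] inj_on_add_leaf[OF x, of u "{u}"]
    by (simp add: card_image)
qed

definition order_sum :: "'a set \<Rightarrow> 'a sgraph \<Rightarrow> nat" where
  "order_sum X G = (\<Sum>T\<in>subtrees_containing X G. card (verts T))"

text \<open>As \<open>u\<close> lies in \<open>X\<close>, every tree counted occurs once unchanged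
  and once with the leaf, the latter with one more vertex.\<close>

lemma order_sum_add_leaf:
  assumes G: "simple_graph G" and X: "u \<in> X" "X \<subseteq> verts G" and x: "x \<notin> verts G"
  shows "order_sum X (add_leaf u x G) = 2 * order_sum X G + card (subtrees_containing X G)"
proof -
  have "card (verts (add_leaf u x T)) = card (verts T) + 1" if "T \<in> subtrees_containing X G" for T
    using that x notin_subtree[of T G x]
    by (auto simp: subtrees_containing_def subtrees_def subgraph_def simple_graph_def)
  moreover have "insert u X = X" "u \<in> verts G" "X \<noteq> {}" using X by auto
  ultimately show ?thesis
    using assms
    by (simp add: order_sum_def subtrees_containing_add_leaf sum.union_disjoint disjoint_add_leaf
        finite_subtrees_containing sum.reindex inj_on_add_leaf sum_Suc del: verts_add_leaf)
qed

text \<open>Inclusion-exclusion. It lets the recursion for the number of all subtrees close without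
  separate counts for trees through a single end.\<close>

lemma card_subtrees_containing_pair:
  assumes "simple_graph G"
  shows "card (subtrees_containing {u} G) + card (subtrees_containing {v} G)
    \<le> card (subtrees G) + card (subtrees_containing {u, v} G)"
proof -
  let ?U = "subtrees_containing {u} G" and ?V = "subtrees_containing {v} G"
  have "?U \<inter> ?V = subtrees_containing {u, v} G" by (auto simp: subtrees_containing_def)
  moreover have "card (?U \<union> ?V) \<le> card (subtrees G)"
    by (intro card_mono finite_subtrees assms) (auto simp: subtrees_containing_def)
  ultimately show ?thesis
    using card_Un_Int[of ?U ?V] finite_subtrees_containing[OF assms] by simp
qed

section \<open>Attaching leaves at both ends of the core, and the resulting counts\<close>

text \<open>The leaves at \<open>0\<close> and at \<open>n\<close> are the odd and the even offsets from \<open>n\<close>, so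
  that they are fresh if the vertices of the core are \<open>{..n}\<close>.\<close>

fun brush :: "nat \<Rightarrow> nat sgraph \<Rightarrow> nat \<Rightarrow> nat sgraph" where
  "brush n G 0 = G"
| "brush n G (Suc s) = add_leaf n (n + 2 * s + 2) (add_leaf 0 (n + 2 * s + 1) (brush n G s))"

lemma verts_brush: "verts G = {..n} \<Longrightarrow> verts (brush n G s) = {..n + 2 * s}"
  by (induction s) auto

lemma connected_graph_brush:
  assumes "connected_graph G" "verts G = {..n}"
  shows "connected_graph (brush n G s)"
  using assms by (induction s) (auto intro!: connected_graph_add_leaf simp: verts_brush)

lemma simple_graph_brush:
  assumes "simple_graph G" "verts G = {..n}"
  shows "simple_graph (brush n G s)"
  using assms by (induction s) (auto intro!: simple_graph_add_leaf simp: verts_brush)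

lemma edges_brush_mono: "edges G \<subseteq> edges H \<Longrightarrow> edges (brush n G s) \<subseteq> edges (brush n H s)"
  by (induction s) auto

text \<open>Each leaf edge is inserted into both graphs and is new to the larger one, so the
  difference stays the same.\<close>

lemma edges_brush_diff:
  assumes H: "simple_graph H" and V: "verts H = {..n}"
  shows "edges (brush n H s) - edges (brush n G s) = edges H - edges G"
proof (induction s)
  case (Suc s)
  have "{a, b} \<notin> edges (brush n H s)" if "b > n + 2 * s" for a b
    using simple_graph_edge_verts(2)[OF simple_graph_brush[OF assms], of a b s] that
    by (auto simp: verts_brush[OF V])
  then have "{n, n + 2 * s + 2} \<notin> edges (brush n H s)" "{0, n + 2 * s + 1} \<notin> edges (brush n H s)"
    by simp_all
  then show ?case using Suc.IH by auto
qed simp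

text \<open>Let one round start with \<open>N\<close> subtrees, \<open>c\<close> of them through
  both ends with order sum \<open>S\<close>. Then \<open>c\<close> becomes \<open>4 * c\<close> and
  \<open>S\<close> becomes \<open>4 * S + 4 * c\<close>. By inclusion-exclusion \<open>N\<close>
  becomes at most \<open>2 * N + 2 * c + 2\<close>; the shift by 2 in the third claim absorbs this
  constant.\<close>

lemma brush_counts:
  assumes G: "simple_graph G" and V: "verts G = {..n}"
  defines "a \<equiv> card (subtrees_containing {0, n} G)"
  shows "card (subtrees_containing {0, n} (brush n G s)) = 4 ^ s * a"
    and "order_sum {0, n} (brush n G s) = 4 ^ s * (order_sum {0, n} G + s * a)"
    and "card (subtrees (brush n G s)) + 2 \<le> 4 ^ s * a + 2 ^ s * (card (subtrees G) + 2)"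
proof (induction s)
  case 0
  { case 1 show ?case by (simp add: a_def) }
  { case 2 show ?case by simp }
  { case 3 show ?case by simp }
next
  case (Suc s)
  let ?B = "brush n G s"
  let ?C = "add_leaf 0 (n + 2 * s + 1) ?B"
  have B: "simple_graph ?B" "verts ?B = {..n + 2 * s}"
    using simple_graph_brush[OF G V] verts_brush[OF V] by auto
  have C: "simple_graph ?C" using B by (intro simple_graph_add_leaf) auto
  have VC: "verts ?C = {..n + 2 * s + 1}" using B by auto
  have [simp]: "insert n {0, n} = {0, n}" by auto
  have N0: "card (subtrees_containing {0, n} ?C) = 2 * card (subtrees_containing {0, n} ?B)"
    using card_subtrees_containing_add_leaf[OF B(1), of 0 "n + 2 * s + 1" "{0, n}"] B by simp
  have N: "card (subtrees_containing {0, n} (brush n G (Suc s)))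
      = 4 * card (subtrees_containing {0, n} ?B)"
    using card_subtrees_containing_add_leaf[OF C, of n "n + 2 * s + 2" "{0, n}"] B N0 by simp
  { case 1 show ?case using N Suc.IH(1) by simp }
  { case 2
    have "order_sum {0, n} (brush n G (Suc s))
        = 2 * (2 * order_sum {0, n} ?B + card (subtrees_containing {0, n} ?B))
          + 2 * card (subtrees_containing {0, n} ?B)"
      using order_sum_add_leaf[OF C, of n "{0, n}" "n + 2 * s + 2"] VC N0
        order_sum_add_leaf[OF B(1), of 0 "{0, n}" "n + 2 * s + 1"] B by simp
    then show ?case using Suc.IH by (simp add: algebra_simps) }
  { case 3
    have "card (subtrees_containing {n} ?C)
        = card (subtrees_containing {n} ?B) + card (subtrees_containing {0, n} ?B)"
      using card_subtrees_containing_add_leaf[OF B(1), of 0 "n + 2 * s + 1" "{n}"] B by simp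
    then have "card (subtrees (brush n G (Suc s))) = card (subtrees ?B)
        + card (subtrees_containing {0} ?B) + card (subtrees_containing {n} ?B)
        + card (subtrees_containing {0, n} ?B) + 2"
      using card_subtrees_add_leaf[OF C, of n "n + 2 * s + 2"] VC
        card_subtrees_add_leaf[OF B(1), of 0 "n + 2 * s + 1"] B by simp
    \<comment> \<open>With these products named, the induction step is linear:
      \<open>2 * (q + w) + 2 * q = 4 * q + 2 * w\<close>.\<close>
    moreover define q w where "q = 4 ^ s * a" and "w = 2 ^ s * (card (subtrees G) + 2)"
    moreover have "4 ^ Suc s * a = 4 * q" "2 ^ Suc s * (card (subtrees G) + 2) = 2 * w"
      by (simp_all add: q_def w_def)
    ultimately show ?case
      using card_subtrees_containing_pair[OF B(1), of 0 n] Suc.IH(1,3) by linarith }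
qed

section \<open>Bounds on the mean and the asymptotic comparison\<close>

lemma mean_subtree_order_ge:
  assumes "simple_graph G"
  shows "real (order_sum X G) / real (card (subtrees G)) \<le> mean_subtree_order G"
proof -
  have "order_sum X G \<le> (\<Sum>T\<in>subtrees G. card (verts T))"
    unfolding order_sum_def
    by (intro sum_mono2 finite_subtrees assms) (auto simp: subtrees_containing_def)
  then have "real (order_sum X G) \<le> (\<Sum>T\<in>subtrees G. real (card (verts T)))"
    by (metis of_nat_le_iff of_nat_sum)
  then show ?thesis
    by (simp add: mean_subtree_order_def divide_right_mono)
qed

text \<open>Trees outside the family are given the largest conceivable order in the numerator and
  are dropped from the denominator. This is affordable when they are few, as in a brush, where their
  share is of order \<open>1 / 2 ^ s\<close>.\<close>

lemma mean_subtree_order_le: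
  assumes G: "simple_graph G" and ne: "subtrees_containing X G \<noteq> {}"
  defines "a \<equiv> real (card (subtrees_containing X G))"
  shows "mean_subtree_order G \<le>
    (real (order_sum X G) + (real (card (subtrees G)) - a) * real (card (verts G))) / a"
proof -
  let ?A = "subtrees_containing X G" and ?m = "real (card (verts G))"
  have sub: "?A \<subseteq> subtrees G" by (auto simp: subtrees_containing_def)
  have fin: "finite (subtrees G)" by (rule finite_subtrees[OF G])
  have le: "card ?A \<le> card (subtrees G)" by (rule card_mono[OF fin sub])
  have pos: "card ?A > 0" using ne finite_subtrees_containing[OF G] by (simp add: card_gt_0_iff)
  have "real (card (verts T)) \<le> ?m" if "T \<in> subtrees G" for T
    using that G by (auto simp: subtrees_def subgraph_def simple_graph_def intro: card_mono)
  then have "(\<Sum>T\<in>subtrees G - ?A. real (card (verts T))) \<le> real (card (subtrees G - ?A)) * ?m"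
    by (intro sum_bounded_above) auto
  also have "real (card (subtrees G - ?A)) = real (card (subtrees G)) - a"
    using le by (simp add: card_Diff_subset[OF finite_subset[OF sub fin] sub] a_def)
  finally have "(\<Sum>T\<in>subtrees G. real (card (verts T)))
      \<le> real (order_sum X G) + (real (card (subtrees G)) - a) * ?m"
    by (simp add: sum.subset_diff[OF sub fin] order_sum_def)
  then show ?thesis
    unfolding mean_subtree_order_def using le pos
    by (intro frac_le) (auto simp: a_def intro: sum_nonneg add_nonneg_nonneg)
qed

text \<open>Both means are compared with \<open>m + s\<close>, where \<open>m = n + 1\<close> is the
  order of the core. The mean of the brush on \<open>G\<close> falls below it by at most a vanishing
  error, that of the brush on \<open>H\<close> stays below it by \<open>1 / b\<close> up to a
  vanishing error.\<close>

lemma eventually_mean_brush_less: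
  assumes G: "simple_graph G" "verts G = {..n}" and H: "simple_graph H" "verts H = {..n}"
    and G_ne: "subtrees_containing {0, n} G \<noteq> {}"
    and G_full: "\<And>T. T \<in> subtrees_containing {0, n} G \<Longrightarrow> verts T = {..n}"
    and H_small: "T0 \<in> subtrees_containing {0, n} H" "card (verts T0) \<le> n"
  shows "\<forall>\<^sub>F s in sequentially. mean_subtree_order (brush n H s) < mean_subtree_order (brush n G s)"
proof -
  define a b where "a = real (card (subtrees_containing {0, n} G))"
    and "b = real (card (subtrees_containing {0, n} H))"
  define R Q where "R = real (card (subtrees G) + 2)" and "Q = real (card (subtrees H) + 2)"
  define m where "m = real (n + 1)"
  have a: "a > 0" using G_ne finite_subtrees_containing[OF G(1)] by (simp add: a_def card_gt_0_iff)
  have b: "b > 0"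
    using H_small finite_subtrees_containing[OF H(1)] by (auto simp: b_def card_gt_0_iff)
  have R: "R > 0" and m: "m > 0" by (auto simp: R_def m_def)
  have SG: "real (order_sum {0, n} G) = a * m"
    using G_full by (simp add: order_sum_def a_def m_def algebra_simps)
  \<comment> \<open>Each of the \<open>b\<close> trees has order at most \<open>m\<close>, and
    \<open>T0\<close> misses a vertex. The deficit of 1, divided by \<open>b\<close>, becomes the
    gap \<open>1 / b\<close>.\<close>
  have SH: "real (order_sum {0, n} H) \<le> b * m - 1"
  proof -
    have "order_sum {0, n} H < (\<Sum>T\<in>subtrees_containing {0, n} H. n + 1)"
      unfolding order_sum_def
    proof (rule sum_strict_mono_ex1[OF finite_subtrees_containing[OF H(1)]])
      show "\<forall>T\<in>subtrees_containing {0, n} H. card (verts T) \<le> n + 1"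
      proof
        fix T assume "T \<in> subtrees_containing {0, n} H"
        then have "verts T \<subseteq> {..n}"
          using H(2) by (auto simp: subtrees_containing_def subtrees_def subgraph_def)
        then show "card (verts T) \<le> n + 1" using card_mono[of "{..n}" "verts T"] by simp
      qed
      show "\<exists>T\<in>subtrees_containing {0, n} H. card (verts T) < n + 1"
        using H_small by force
    qed
    then have "order_sum {0, n} H + 1 \<le> card (subtrees_containing {0, n} H) * (n + 1)"
      by simp
    then have "real (order_sum {0, n} H + 1) \<le> real (card (subtrees_containing {0, n} H) * (n + 1))"
      by (rule of_nat_mono)
    then show ?thesis by (simp add: b_def m_def algebra_simps)
  qed
  \<comment> \<open>The first term is the loss in the lower bound for \<open>G\<close>, the second
    the surplus in the upper bound for \<open>H\<close>. Both are linear over exponential, so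
    together they finally drop below the gap.\<close>
  have "((\<lambda>s. (m + real s) * (R / a) / 2 ^ s + Q / b * (m + 2 * real s) / 2 ^ s) \<longlongrightarrow> 0) sequentially"
    by real_asymp
  then have "\<forall>\<^sub>F s in sequentially.
      (m + real s) * (R / a) / 2 ^ s + Q / b * (m + 2 * real s) / 2 ^ s < 1 / b"
    using b by (intro order_tendstoD) auto
  then show ?thesis
  proof eventually_elim
    case (elim s)
    let ?p = "(2::real) ^ s"
    have four: "(4::real) ^ s = ?p * ?p" by (simp flip: power_mult_distrib)
    have p: "?p > 0" by simp
    note cG = brush_counts[OF G, of s] and cH = brush_counts[OF H, of s]
    have NG: "real (card (subtrees (brush n G s))) \<le> ?p * ?p * a + ?p * R"
    proof -
      have "real (card (subtrees (brush n G s)) + 2) \<le>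
          real (4 ^ s * card (subtrees_containing {0, n} G) + 2 ^ s * (card (subtrees G) + 2))"
        using cG(3) by (rule of_nat_mono)
      then show ?thesis by (simp add: a_def R_def four algebra_simps)
    qed
    have NH: "real (card (subtrees (brush n H s))) - ?p * ?p * b \<le> ?p * Q"
    proof -
      have "real (card (subtrees (brush n H s)) + 2) \<le>
          real (4 ^ s * card (subtrees_containing {0, n} H) + 2 ^ s * (card (subtrees H) + 2))"
        using cH(3) by (rule of_nat_mono)
      then show ?thesis by (simp add: b_def Q_def four algebra_simps)
    qed
    have aH: "real (card (subtrees_containing {0, n} (brush n H s))) = ?p * ?p * b"
      using cH(1) by (simp add: b_def four)
    then have neH: "subtrees_containing {0, n} (brush n H s) \<noteq> {}"
      using b p by (metis card.empty mult_pos_pos of_nat_0 order_less_irrefl)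
    have oG: "real (order_sum {0, n} (brush n G s)) = ?p * ?p * a * (m + s)"
      using cG(2) SG by (simp add: a_def four algebra_simps)
    have oH: "real (order_sum {0, n} (brush n H s)) \<le> ?p * ?p * (b * m - 1 + s * b)"
      using cH(2) SH by (simp add: b_def four)
    have vH: "real (card (verts (brush n H s))) = m + 2 * s"
      by (simp add: verts_brush[OF H(2)] m_def)
    have cpos: "0 < real (card (subtrees (brush n G s)))"
    proof -
      have "SGraph {0} {} \<in> subtrees (brush n G s)"
        using simple_graph_brush[OF G] by (intro singleton_subtree) (auto simp: verts_brush[OF G(2)])
      then show ?thesis
        using finite_subtrees[OF simple_graph_brush[OF G, of s]] by (auto simp: card_gt_0_iff)
    qed
    have "mean_subtree_order (brush n H s)
        \<le> (?p * ?p * (b * m - 1 + s * b) + ?p * Q * (m + 2 * s)) / (?p * ?p * b)"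
      using mean_subtree_order_le[OF simple_graph_brush[OF H] neH] NH oH m b p
      unfolding aH vH
      by (elim order_trans) (intro divide_right_mono add_mono mult_right_mono, auto)
    also have "\<dots> = m + s - 1 / b + Q / b * (m + 2 * s) / ?p"
      using b p by (simp add: field_simps)
    also have "\<dots> < (m + s) - (m + s) * (R / a) / ?p"
      using elim by simp
    also have "\<dots> \<le> ?p * ?p * a * (m + s) / (?p * ?p * a + ?p * R)"
    proof -
      \<comment> \<open>\<open>y\<close> bounds the excess of the denominator relative to its main
        term. The estimate is then \<open>1 - y \<le> 1 / (1 + y)\<close>.\<close>
      define y where "y = R / a / ?p"
      have y: "y > 0" using a R p by (simp add: y_def)
      have "?p * ?p * a * (m + s) / (?p * ?p * a + ?p * R) = (m + s) / (1 + y)"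
      proof -
        have "?p * ?p * a + ?p * R = ?p * ?p * a * (1 + y)"
          using a by (simp add: y_def field_simps)
        then show ?thesis using a by simp
      qed
      moreover have "(m + s) * (1 - y) \<le> (m + s) / (1 + y)"
      proof -
        have "(1 - y) * (1 + y) \<le> 1" by (simp add: algebra_simps)
        then have "(m + s) * ((1 - y) * (1 + y)) \<le> (m + s) * 1"
          using m by (intro mult_left_mono) auto
        then show ?thesis using y by (simp add: pos_le_divide_eq mult.assoc)
      qed
      moreover have "(m + s) * (1 - y) = (m + s) - (m + s) * (R / a) / ?p"
        by (simp add: y_def right_diff_distrib)
      ultimately show ?thesis by metis
    qed
    also have "\<dots> \<le> real (order_sum {0, n} (brush n G s)) / real (card (subtrees (brush n G s)))"
      unfolding oG using NG cpos a m by (intro divide_left_mono mult_pos_pos) auto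
    also have "\<dots> \<le> mean_subtree_order (brush n G s)"
      by (rule mean_subtree_order_ge[OF simple_graph_brush[OF G]])
    finally show ?case .
  qed
qed

section \<open>The path and the fan\<close>

text \<open>Building the path leaf by leaf makes it a tree by the results on
  \<open>add_leaf\<close>.\<close>

fun path_graph :: "nat \<Rightarrow> nat sgraph" where
  "path_graph 0 = SGraph {0} {}"
| "path_graph (Suc n) = add_leaf n (Suc n) (path_graph n)"

lemma verts_path_graph [simp]: "verts (path_graph n) = {..n}"
  by (induction n) auto

lemma edges_path_graph: "edges (path_graph n) = (\<lambda>i. {i, Suc i}) ` {..<n}"
  by (induction n) (auto simp: lessThan_Suc)

lemma is_tree_path_graph: "is_tree (path_graph n)"
  by (induction n) (auto intro: is_tree_singleton is_tree_add_leaf)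

lemma simple_path_graph: "simple_graph (path_graph n)"
  using is_tree_path_graph by (simp add: is_tree_def connected_graph_def)

text \<open>A discrete intermediate value argument: a walk in the path rises by at most 1 per step,
  so a walk from 0 that misses \<open>j\<close> stays below \<open>j\<close> and never reaches
  \<open>n\<close>.\<close>

lemma path_graph_subtree_full:
  assumes T: "T \<in> subtrees_containing {0, n} (path_graph n)"
  shows "verts T = {..n}"
proof -
  have simT: "simple_graph T" and eT: "edges T \<subseteq> (\<lambda>i. {i, Suc i}) ` {..<n}"
    and vT: "verts T \<subseteq> {..n}" and ends: "0 \<in> verts T" "n \<in> verts T"
    and con: "(0, n) \<in> (adj T)\<^sup>*"
    using T by (auto simp: subtrees_containing_def subtrees_def subgraph_def is_tree_def
        connected_graph_def edges_path_graph)
  have "j \<in> verts T" if j: "j \<le> n" for j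
  proof (rule ccontr)
    assume nj: "j \<notin> verts T"
    have "b < j" if "(0, b) \<in> (adj T)\<^sup>*" for b
      using that
    proof (induction rule: rtrancl_induct)
      case base
      show ?case using nj ends by (cases j) auto
    next
      case (step b c)
      then have e: "{b, c} \<in> edges T" by (simp add: adj_def)
      then have "c \<noteq> j" using simple_graph_edge_verts[OF simT] nj by blast
      moreover have "{b, c} \<in> (\<lambda>i. {i, Suc i}) ` {..<n}" using e eT by blast
      then have "c \<le> Suc b" by (auto simp: doubleton_eq_iff)
      ultimately show ?case using step.IH by linarith
    qed
    then show False using con j by force
  qed
  with vT show ?thesis by auto
qed

text \<open>The vertex 0 is joined to all other vertices of the path. The chords start at 2 because
  \<open>{0, 1}\<close> is a path edge, and for \<open>n \<ge> 2\<close> the last one joins the two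
  ends.\<close>

definition fan_graph :: "nat \<Rightarrow> nat sgraph" where
  "fan_graph n = SGraph {..n} (edges (path_graph n) \<union> (\<lambda>j. {0, j}) ` {2..n})"

lemma subgraph_path_fan: "subgraph (path_graph n) (fan_graph n)"
  using simple_path_graph[of n] by (auto simp: subgraph_def fan_graph_def simple_graph_def)

lemma card_fan_minus_path: "card (edges (fan_graph n) - edges (path_graph n)) = n - 1"
proof -
  have "edges (fan_graph n) - edges (path_graph n) = (\<lambda>j. {0, j}) ` {2..n}"
    by (auto simp: fan_graph_def edges_path_graph doubleton_eq_iff)
  moreover have "inj_on (\<lambda>j. {0::nat, j}) {2..n}"
    by (auto simp: inj_on_def doubleton_eq_iff)
  ultimately show ?thesis by (simp add: card_image)
qed

section \<open>The infinite family of pairs\<close>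

lemma connected_graph_supergraph:
  assumes "connected_graph G" "subgraph G H" "verts G = verts H"
  shows "connected_graph H"
  using assms rtrancl_mono[OF adj_mono[of G H]]
  unfolding connected_graph_def subgraph_def by blast

theorem theorem1:
  fixes k :: nat
  assumes "k \<ge> 1"
  shows "\<exists>P :: (nat sgraph \<times> nat sgraph) set.
    infinite P \<and>
    pairwise (\<lambda>p q. \<not> pair_isomorphic p q) P \<and>
    (\<forall>(G, H)\<in>P.
       connected_graph G \<and> connected_graph H \<and>
       subgraph G H \<and> verts G = verts H \<and>
       card (edges H - edges G) = k \<and>
       mean_subtree_order H < mean_subtree_order G)"
proof -
  \<comment> \<open>The fan has \<open>n - 1\<close> edges more than the path, which must equal
    \<open>k\<close>.\<close>
  define n where "n = k + 1"
  define G H where "G = path_graph n" and "H = fan_graph n"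
  have n: "n \<ge> 2" using assms by (simp add: n_def)
  have GH: "subgraph G H" by (simp add: G_def H_def subgraph_path_fan)
  then have G: "simple_graph G" "verts G = {..n}" and H: "simple_graph H" "verts H = {..n}"
    by (auto simp: subgraph_def G_def H_def fan_graph_def)
  have tree: "is_tree G" by (simp add: G_def is_tree_path_graph)
  then have conG: "connected_graph G" by (simp add: is_tree_def)
  have conH: "connected_graph H"
    by (rule connected_graph_supergraph[OF conG GH]) (simp add: G H)
  have ne: "G \<in> subtrees_containing {0, n} G"
    using tree G by (simp add: subtrees_containing_def subtrees_def subgraph_def)
  \<comment> \<open>The chord between the ends is a tree through both of order 2, which is at most
    \<open>n\<close> because \<open>k \<ge> 1\<close>.\<close>
  define T0 where "T0 = add_leaf 0 n (SGraph {0} {})"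
  have T0: "T0 \<in> subtrees_containing {0, n} H"
  proof -
    have "is_tree T0" unfolding T0_def using n by (intro is_tree_add_leaf is_tree_singleton) auto
    moreover from this have "simple_graph T0" by (simp add: is_tree_def connected_graph_def)
    ultimately show ?thesis
      using n H by (auto simp: subtrees_containing_def subtrees_def subgraph_def T0_def H_def
          fan_graph_def)
  qed
  have T0_small: "card (verts T0) \<le> n" using n by (simp add: T0_def card_insert_if)
  let ?f = "\<lambda>s. (brush n G s, brush n H s)"
  define I where "I = {s. mean_subtree_order (brush n H s) < mean_subtree_order (brush n G s)}"
  have "\<forall>\<^sub>F s in sequentially. s \<in> I"
    unfolding I_def mem_Collect_eq
    using ne T0 T0_small path_graph_subtree_full[of _ n]
    by (intro eventually_mean_brush_less[OF G H]) (auto simp: G_def)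
  then obtain N where "{N..} \<subseteq> I"
    by (auto simp: eventually_sequentially)
  then have infI: "infinite I" using infinite_Ici finite_subset by blast
  have card_V: "card (verts (brush n G s)) = n + 2 * s + 1" for s
    by (simp add: verts_brush[OF G(2)])
  \<comment> \<open>The number of vertices, \<open>n + 2 * s + 1\<close>, already tells different
    \<open>s\<close> apart.\<close>
  have iso: "s = t" if "pair_isomorphic (?f s) (?f t)" for s t
  proof -
    have "card (verts (brush n G s)) = card (verts (brush n G t))"
      using that by (auto simp: pair_isomorphic_def graph_iso_def dest: bij_betw_same_card)
    then show ?thesis by (simp add: card_V)
  qed
  have "inj_on ?f I" by (intro inj_onI) (metis card_V add_right_cancel add_left_cancel
      mult_cancel1 zero_neq_numeral prod.inject)
  with infI have "infinite (?f ` I)" by (simp add: finite_image_iff)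
  moreover have "pairwise (\<lambda>p q. \<not> pair_isomorphic p q) (?f ` I)"
    unfolding pairwise_def using iso by blast
  moreover have "connected_graph G' \<and> connected_graph H' \<and> subgraph G' H' \<and> verts G' = verts H' \<and>
       card (edges H' - edges G') = k \<and> mean_subtree_order H' < mean_subtree_order G'"
    if "(G', H') \<in> ?f ` I" for G' H'
  proof -
    obtain s where "s \<in> I" "(G', H') = ?f s" using \<open>(G', H') \<in> ?f ` I\<close> by blast
    then have s: "s \<in> I" "G' = brush n G s" "H' = brush n H s" by simp_all
    have "subgraph G' H'"
      using GH simple_graph_brush[OF G] simple_graph_brush[OF H] edges_brush_mono[of G H n s]
      by (simp add: subgraph_def s verts_brush[OF G(2)] verts_brush[OF H(2)])
    moreover have "card (edges H' - edges G') = k"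
      using card_fan_minus_path[of n] edges_brush_diff[OF H, of s G]
      by (simp add: s G_def H_def n_def)
    ultimately show ?thesis
      using s connected_graph_brush[OF conG G(2)] connected_graph_brush[OF conH H(2)]
      by (simp add: I_def verts_brush[OF G(2)] verts_brush[OF H(2)])
  qed
  ultimately show ?thesis by (intro exI[of _ "?f ` I"]) blast
qed

end
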